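(* Let $d\in\mathbb N_+$, $L>0$, $1\le p\le\infty$, $X=[0,1]^d$, and fix an $L$-Lipschitz function $f:([0,1]^d,\|\cdot\|_p)\to(\mathbb R,|\cdot|)$. For every integer $N\ge2$ there exists a ReLU-MLP $\Phi:\mathbb R^d\to\mathbb R$ of depth $\mathcal O(\log N)$, width $\mathcal O(N)$, and with $\mathcal O(N)$ nonzero parameters such that: (i) $\displaystyle\sup_{x\in[0,1]^d}|f(x)-\Phi(x)|\le\frac{C'_{p,d}\,L}{N^{1/d}}$; (ii) $\Phi$ is $L\,d^{\min\{1/p,\,1-1/p\}}$-Lipschitz with respect to $\|\cdot\|_p$, where $C'_{p,d}:=d$ if $1\le p\le2$ and $C'_{p,d}:=d^{1/p}$ if $2<p\le\infty$.
   Context: Convention $1/\infty=0$. The constants hidden in $\mathcal O(\cdot)$ depend only on $d$. ReLU-MLP: a map $\mathbb R^{d_0}\to\mathbb R^{d_L}$ of the form $X^{(0)}=x$, $X^{(j+1)}=\operatorname{ReLU}(A^{(j)}X^{(j)}+b^{(j)})$ componentwise for $j=0,\dots,L_{\rm net}-2$, with output $A^{(L_{\rm net}-1)}X^{(L_{\rm net}-1)}+b^{(L_{\rm net}-1)}$; $L_{\rm net}$ is its depth, the maximal layer dimension is its width, and the number of nonzero parameters is the total number of nonzero entries of all $A^{(j)},b^{(j)}$. *)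

theory Defs
  imports Complex_Main "HOL-Library.Extended_Real" "Jordan_Normal_Form.Matrix"
begin

text \<open>
  The space \<open>\<real>\<^sup>d\<close> is \<^term>\<open>carrier_vec d\<close>, so that the layer dimensions of a network can vary with
  the network. Exponents \<open>p\<close> range over the extended reals, and since \<open>1 / \<infinity> = 0\<close> holds in
  \<^typ>\<open>ereal\<close>, the convention \<open>1 / \<infinity> = 0\<close> is built into the following definition.
\<close>

definition inv_exponent :: "ereal \<Rightarrow> real" where
  "inv_exponent p = real_of_ereal (1 / p)"

definition pnorm :: "ereal \<Rightarrow> real vec \<Rightarrow> real" where
  "pnorm p x =
     (if p = \<infinity> then Max ((\<lambda>i. \<bar>x $ i\<bar>) ` {..<dim_vec x})
      else (\<Sum>i<dim_vec x. \<bar>x $ i\<bar> powr real_of_ereal p) powr inv_exponent p)"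

definition lipschitz_pnorm :: "ereal \<Rightarrow> real \<Rightarrow> real vec set \<Rightarrow> (real vec \<Rightarrow> real) \<Rightarrow> bool" where
  "lipschitz_pnorm p K S g \<longleftrightarrow>
     0 \<le> K \<and> (\<forall>x\<in>S. \<forall>y\<in>S. \<bar>g x - g y\<bar> \<le> K * pnorm p (x - y))"

definition unit_cube :: "nat \<Rightarrow> real vec set" where
  "unit_cube d = {x \<in> carrier_vec d. \<forall>i<d. 0 \<le> x $ i \<and> x $ i \<le> 1}"

text \<open>
  A network is the list of its affine layers \<open>(A, b)\<close>, the layer applied first being the head of
  the list.
\<close>

type_synonym relu_mlp = "(real mat \<times> real vec) list"

definition relu :: "real vec \<Rightarrow> real vec" where
  "relu x = map_vec (\<lambda>t. max 0 t) x"

text \<open>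
  \<open>is_mlp m n \<Phi>\<close>: the layers of \<open>\<Phi>\<close> fit together to a map \<open>\<real>\<^sup>m \<rightarrow> \<real>\<^sup>n\<close>; there is at least one
  layer, and no hidden layer has dimension 0.
\<close>

fun is_mlp :: "nat \<Rightarrow> nat \<Rightarrow> relu_mlp \<Rightarrow> bool" where
  "is_mlp m n [] \<longleftrightarrow> False"
| "is_mlp m n [(A, b)] \<longleftrightarrow> A \<in> carrier_mat n m \<and> b \<in> carrier_vec n"
| "is_mlp m n ((A, b) # l # ls) \<longleftrightarrow>
     (\<exists>k>0. A \<in> carrier_mat k m \<and> b \<in> carrier_vec k \<and> is_mlp k n (l # ls))"

text \<open>ReLU is applied after every layer except the last one.\<close>

fun mlp_eval :: "relu_mlp \<Rightarrow> real vec \<Rightarrow> real vec" where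
  "mlp_eval [] x = x"
| "mlp_eval [(A, b)] x = A *\<^sub>v x + b"
| "mlp_eval ((A, b) # l # ls) x = mlp_eval (l # ls) (relu (A *\<^sub>v x + b))"

definition mlp_fun :: "relu_mlp \<Rightarrow> real vec \<Rightarrow> real" where
  "mlp_fun \<Phi> x = mlp_eval \<Phi> x $ 0"

definition mlp_depth :: "relu_mlp \<Rightarrow> nat" where
  "mlp_depth \<Phi> = length \<Phi>"

text \<open>The maximum is over all layer dimensions, those of the input and output included.\<close>

definition mlp_width :: "relu_mlp \<Rightarrow> nat" where
  "mlp_width \<Phi> = Max (\<Union>(A, b)\<in>set \<Phi>. {dim_col A, dim_row A})"

definition mlp_nonzero_params :: "relu_mlp \<Rightarrow> nat" where
  "mlp_nonzero_params \<Phi> =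
     (\<Sum>(A, b)\<leftarrow>\<Phi>. card {(i, j). i < dim_row A \<and> j < dim_col A \<and> A $$ (i, j) \<noteq> 0}
                + card {i. i < dim_vec b \<and> b $ i \<noteq> 0})"

definition approx_const :: "ereal \<Rightarrow> nat \<Rightarrow> real" where
  "approx_const p d = (if p \<le> 2 then real d else real d powr inv_exponent p)"

end

(*
  McShane extension from a grid: let x_k be the centres of (2^a)^d congruent cells with
  N <= 2^(a d) <= 2^d N, let c = min_k f(x_k) and
    Phi(x) = max(c, max_k (f(x_k) - Lam * nu(x - x_k))),
  where nu is the l^1 norm and Lam = L if p <= 2, while nu is the maximum norm and
  Lam = L d^(1/p) if p > 2. In both cases Lam * nu dominates L * ||.||_p, so that Phi stays within
  2 Lam nu(x - x_k) of f for the nearest centre x_k, and the Lipschitz constant of Phi comes from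
  the comparison of nu with ||.||_p. Both norms are maxima of at most 2^d linear functionals, which
  makes Phi a maximum of minima of rectified affine functions, and these are evaluated by binary
  trees of ReLU layers of geometrically decreasing width.
*)

theory Submission
  imports Defs
begin

section \<open>Networks computing a maximum of minima of rectified affine functions\<close>

definition hidden_eval :: "relu_mlp \<Rightarrow> real vec \<Rightarrow> real vec" where
  "hidden_eval ls x = fold (\<lambda>(A, b) v. relu (A *\<^sub>v v + b)) ls x"

text \<open>In \<open>hidden_eval\<close> ReLU follows every layer, and here the empty list fits as
  the identity, so blocks compose by concatenation. This fails for \<open>mlp_eval\<close>, whose
  last layer is affine.\<close>

fun hidden_fits :: "nat \<Rightarrow> relu_mlp \<Rightarrow> nat \<Rightarrow> bool" where
  "hidden_fits m [] n \<longleftrightarrow> m = n"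
| "hidden_fits m ((A, b) # ls) n \<longleftrightarrow>
     dim_row A > 0 \<and> dim_col A = m \<and> dim_vec b = dim_row A \<and> hidden_fits (dim_row A) ls n"

lemma hidden_eval_simps [simp]:
  "hidden_eval [] x = x"
  "hidden_eval ((A, b) # ls) x = hidden_eval ls (relu (A *\<^sub>v x + b))"
  "hidden_eval (ks @ ls) x = hidden_eval ls (hidden_eval ks x)"
  by (simp_all add: hidden_eval_def)

lemma hidden_fits_append:
  "hidden_fits m ks k \<Longrightarrow> hidden_fits k ls n \<Longrightarrow> hidden_fits m (ks @ ls) n"
  by (induction m ks k rule: hidden_fits.induct) auto

lemma is_mlp_append_output:
  assumes "hidden_fits m ls k" "A \<in> carrier_mat n k" "b \<in> carrier_vec n"
  shows "is_mlp m n (ls @ [(A, b)])"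
  using assms
proof (induction m ls k rule: hidden_fits.induct)
  case (2 m B c ls k)
  have "is_mlp (dim_row B) n (ls @ [(A, b)])"
    by (rule "2.IH") (use "2.prems" in auto)
  \<comment> \<open>The tail is written as a cons because the third equation of
    \<open>is_mlp\<close> matches only lists of at least two layers.\<close>
  moreover obtain l ls' where "ls @ [(A, b)] = l # ls'"
    by (cases ls) auto
  moreover have "B \<in> carrier_mat (dim_row B) m" "c \<in> carrier_vec (dim_row B)" "dim_row B > 0"
    using "2.prems"(1) by (auto intro: carrier_vecI)
  ultimately show ?case
    unfolding append_Cons by (metis is_mlp.simps(3))
qed simp

lemma mlp_eval_append_output: "mlp_eval (ls @ [(A, b)]) x = A *\<^sub>v hidden_eval ls x + b"
proof (induction ls arbitrary: x)
  case (Cons l ls)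
  then show ?case by (cases l; cases ls) auto
qed simp

lemma mlp_nonzero_params_append [simp]:
  "mlp_nonzero_params (ks @ ls) = mlp_nonzero_params ks + mlp_nonzero_params ls"
  by (simp add: mlp_nonzero_params_def)

lemma mlp_nonzero_params_Nil [simp]: "mlp_nonzero_params [] = 0"
  by (simp add: mlp_nonzero_params_def)

lemma card_nonzero_vec_le: "card {i. i < dim_vec b \<and> b $ i \<noteq> 0} \<le> dim_vec b"
  using card_mono[of "{..<dim_vec b}" "{i. i < dim_vec b \<and> b $ i \<noteq> 0}"] by auto

lemma mlp_nonzero_params_singleton_le:
  "mlp_nonzero_params [(A, b)] \<le> dim_row A * dim_col A + dim_vec b"
proof -
  have "card {(i, j). i < dim_row A \<and> j < dim_col A \<and> A $$ (i, j) \<noteq> 0}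
      \<le> card ({..<dim_row A} \<times> {..<dim_col A})"
    by (rule card_mono) auto
  then show ?thesis
    using card_nonzero_vec_le[of b] by (simp add: mlp_nonzero_params_def)
qed

lemma mlp_width_le:
  assumes "ls \<noteq> []" "\<And>A b. (A, b) \<in> set ls \<Longrightarrow> dim_row A \<le> W \<and> dim_col A \<le> W"
  shows "mlp_width ls \<le> W"
proof -
  have "finite (\<Union>(A, b)\<in>set ls. {dim_col A, dim_row A})" by auto
  moreover have "(\<Union>(A, b)\<in>set ls. {dim_col A, dim_row A}) \<noteq> {}"
    using assms(1) by (cases ls) auto
  ultimately show ?thesis
    unfolding mlp_width_def using assms(2) by (subst Max_le_iff) auto
qed

section \<open>Sparse layers for pairwise maxima and minima\<close>

definition pair_mat :: "nat \<Rightarrow> nat \<Rightarrow> (nat \<Rightarrow> real) \<Rightarrow> (nat \<Rightarrow> real) \<Rightarrow> real mat" where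
  "pair_mat r n \<alpha> \<beta> =
     mat r (2 * n) (\<lambda>(i, j). if j = i then \<alpha> i else if j = i + n then \<beta> i else 0)"

lemma dim_pair_mat [simp]:
  "dim_row (pair_mat r n \<alpha> \<beta>) = r" "dim_col (pair_mat r n \<alpha> \<beta>) = 2 * n"
  by (simp_all add: pair_mat_def)

text \<open>Row \<open>i\<close> combines the entries \<open>i\<close> and \<open>i + n\<close>; for
  \<open>i \<ge> n\<close> the column \<open>i + n\<close> lies outside the matrix, which leaves a
  multiple of entry \<open>i\<close> alone.\<close>

lemma pair_mat_mult_vec:
  assumes "i < r" "i < 2 * n" "n > 0"
  shows "(pair_mat r n \<alpha> \<beta> *\<^sub>v vec (2 * n) f) $ i =
    \<alpha> i * f i + (if i < n then \<beta> i * f (i + n) else 0)"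
proof -
  have "(pair_mat r n \<alpha> \<beta> *\<^sub>v vec (2 * n) f) $ i =
      (\<Sum>j\<in>{0..<2 * n}. (if j = i then \<alpha> i else if j = i + n then \<beta> i else 0) * f j)"
    using assms by (simp add: pair_mat_def scalar_prod_def)
  also have "\<dots> = (\<Sum>j\<in>{0..<2 * n}.
      (if j = i then \<alpha> i * f i else 0) + (if j = i + n then \<beta> i * f (i + n) else 0))"
    using assms by (intro sum.cong) auto
  finally show ?thesis
    using assms by (simp add: sum.distrib)
qed

text \<open>Nonzero entries of row \<open>i\<close> occur only in the columns \<open>i\<close> and
  \<open>i + n\<close>. This keeps the parameter count linear in the width.\<close>

lemma nonzero_params_pair_mat:
  "mlp_nonzero_params [(pair_mat r n \<alpha> \<beta>, 0\<^sub>v r)] \<le> 2 * r"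
proof -
  have "{(i, j). i < r \<and> j < 2 * n \<and> pair_mat r n \<alpha> \<beta> $$ (i, j) \<noteq> 0}
      \<subseteq> (\<lambda>i. (i, i)) ` {..<r} \<union> (\<lambda>i. (i, i + n)) ` {..<r}"
    by (auto simp: pair_mat_def split: if_splits)
  from card_mono[OF _ this]
  have "card {(i, j). i < r \<and> j < 2 * n \<and> pair_mat r n \<alpha> \<beta> $$ (i, j) \<noteq> 0}
      \<le> card ((\<lambda>i. (i, i)) ` {..<r} \<union> (\<lambda>i. (i, i + n)) ` {..<r})"
    by simp
  also have "\<dots> \<le> card ((\<lambda>i. (i, i)) ` {..<r}) + card ((\<lambda>i. (i, i + n)) ` {..<r})"
    by (rule card_Un_le)
  also have "\<dots> \<le> r + r"
    by (intro add_mono order_trans[OF card_image_le]) auto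
  finally show ?thesis
    by (simp add: mlp_nonzero_params_def cong: conj_cong)
qed

text \<open>
  For \<open>b \<ge> 0\<close> one has \<open>max a b = relu (a - b) + relu b\<close> and \<open>min a b = relu b - relu (b - a)\<close>.
  The sign \<open>\<sigma>\<close> selects the maximum (\<open>\<sigma> = 1\<close>) or the minimum (\<open>\<sigma> = -1\<close>); all values stay
  nonnegative, so that the ReLU of the second layer has no effect.
\<close>

definition halving_level :: "real \<Rightarrow> nat \<Rightarrow> relu_mlp" where
  "halving_level \<sigma> n =
     [(pair_mat (2 * n) n (\<lambda>i. if i < n then \<sigma> else 1) (\<lambda>i. - \<sigma>), 0\<^sub>v (2 * n)),
      (pair_mat n n (\<lambda>i. \<sigma>) (\<lambda>i. 1), 0\<^sub>v n)]"

text \<open>The first layer yields \<open>max 0 (\<sigma> * (f i - f (i + n)))\<close> in the first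
  half and copies \<open>f (i + n)\<close> in the second; the second layer multiplies the former by
  \<open>\<sigma>\<close> and adds the latter.\<close>

lemma hidden_eval_halving_level:
  assumes "\<sigma> \<in> {1, -1}" "n > 0" "\<And>i. i < 2 * n \<Longrightarrow> f i \<ge> 0"
  shows "hidden_eval (halving_level \<sigma> n) (vec (2 * n) f) =
    vec n (\<lambda>i. \<sigma> * max (\<sigma> * f i) (\<sigma> * f (i + n)))"
proof -
  have 1: "relu (pair_mat (2 * n) n (\<lambda>i. if i < n then \<sigma> else 1) (\<lambda>i. - \<sigma>)
      *\<^sub>v vec (2 * n) f + 0\<^sub>v (2 * n)) =
      vec (2 * n) (\<lambda>i. if i < n then max 0 (\<sigma> * (f i - f (i + n))) else f i)"
    (is "?lhs = ?rhs")
  proof (rule eq_vecI)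
    fix i assume "i < dim_vec ?rhs"
    then have i: "i < 2 * n" by simp
    with assms show "?lhs $ i = ?rhs $ i"
      by (auto simp: relu_def pair_mat_mult_vec simp del: index_mult_mat_vec)
  qed (simp add: relu_def)
  have 2: "relu (pair_mat n n (\<lambda>i. \<sigma>) (\<lambda>i. 1) *\<^sub>v
      vec (2 * n) (\<lambda>i. if i < n then max 0 (\<sigma> * (f i - f (i + n))) else f i) + 0\<^sub>v n) =
      vec n (\<lambda>i. \<sigma> * max (\<sigma> * f i) (\<sigma> * f (i + n)))"
    (is "?lhs = ?rhs")
  proof (rule eq_vecI)
    fix i assume "i < dim_vec ?rhs"
    then have i: "i < n" by simp
    with assms(3)[of i] assms(3)[of "i + n"] have "f i \<ge> 0" "f (i + n) \<ge> 0" by auto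
    with assms i show "?lhs $ i = ?rhs $ i"
      by (auto simp: relu_def pair_mat_mult_vec simp del: index_mult_mat_vec)
  qed (simp add: relu_def)
  show ?thesis
    by (simp only: halving_level_def hidden_eval_simps 1 2)
qed

section \<open>Binary trees for maxima and minima of many values\<close>

fun reduction :: "real \<Rightarrow> nat \<Rightarrow> nat \<Rightarrow> relu_mlp" where
  "reduction \<sigma> K 0 = []"
| "reduction \<sigma> K (Suc q) = halving_level \<sigma> (2 ^ q * K) @ reduction \<sigma> K q"

lemma less_Suc_power_cases:
  fixes t :: nat
  assumes "t < 2 ^ Suc q"
  obtains "t < 2 ^ q" | t' where "t = t' + 2 ^ q" "t' < 2 ^ q"
proof (cases "t < 2 ^ q")
  case False
  with assms have "t = (t - 2 ^ q) + 2 ^ q" "t - 2 ^ q < 2 ^ q" by auto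
  then show thesis by (rule that(2))
qed (rule that(1))

text \<open>Entry \<open>j + t * K\<close> is entry \<open>j\<close> of block \<open>t\<close>, and
  each level merges the two halves of the list of blocks. An attained upper bound of
  \<open>\<sigma> * f\<close> describes maxima and minima at once.\<close>

lemma hidden_eval_reduction:
  assumes "\<sigma> \<in> {1, -1}" "K > 0" "\<And>i. i < 2 ^ q * K \<Longrightarrow> f i \<ge> 0"
  shows "\<exists>g. hidden_eval (reduction \<sigma> K q) (vec (2 ^ q * K) f) = vec K g \<and>
    (\<forall>j<K. (\<forall>t<2 ^ q. \<sigma> * f (j + t * K) \<le> \<sigma> * g j) \<and> (\<exists>t<2 ^ q. g j = f (j + t * K)))"
  using assms(3)
proof (induction q arbitrary: f)
  case 0
  then show ?case by auto
next
  case (Suc q)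
  define n where "n = 2 ^ q * K"
  define h where "h i = \<sigma> * max (\<sigma> * f i) (\<sigma> * f (i + n))" for i
  have n: "n > 0" "2 ^ Suc q * K = 2 * n"
    using assms by (auto simp: n_def)
  have h: "\<sigma> * f i \<le> \<sigma> * h i" "\<sigma> * f (i + n) \<le> \<sigma> * h i" "h i = f i \<or> h i = f (i + n)" for i
    using assms(1) by (auto simp: h_def max_def)
  \<comment> \<open>Each \<open>h i\<close> is one of two values of \<open>f\<close>, so
    nonnegativity passes to the next level.\<close>
  have "h i \<ge> 0" if "i < n" for i
    using h(3)[of i] Suc.prems[of i] Suc.prems[of "i + n"] that n by auto
  from Suc.IH[of h] this obtain g where g:
      "hidden_eval (reduction \<sigma> K q) (vec (2 ^ q * K) h) = vec K g"
      "\<And>j t. j < K \<Longrightarrow> t < 2 ^ q \<Longrightarrow> \<sigma> * h (j + t * K) \<le> \<sigma> * g j"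
      "\<And>j. j < K \<Longrightarrow> \<exists>t<2 ^ q. g j = h (j + t * K)"
    unfolding n_def by blast
  have "hidden_eval (halving_level \<sigma> n) (vec (2 * n) f) = vec n h"
    unfolding h_def by (rule hidden_eval_halving_level) (use assms Suc.prems n in auto)
  with g(1) n have "hidden_eval (reduction \<sigma> K (Suc q)) (vec (2 ^ Suc q * K) f) = vec K g"
    by (simp add: n_def mult.assoc)
  \<comment> \<open>A shift by \<open>n\<close> leads from block \<open>t\<close> to block
    \<open>t + 2 ^ q\<close>; hence the cases according to the half in which \<open>t\<close>
    lies.\<close>
  moreover have "\<sigma> * f (j + t * K) \<le> \<sigma> * g j" if j: "j < K" and t: "t < 2 ^ Suc q" for j t
    using t
  proof (cases rule: less_Suc_power_cases)
    case 1
    with h(1)[of "j + t * K"] g(2)[OF j] show ?thesis by fastforce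
  next
    case (2 t')
    with h(2)[of "j + t' * K"] g(2)[OF j 2(2)] show ?thesis
      by (simp add: n_def algebra_simps)
  qed
  moreover have "\<exists>t<2 ^ Suc q. g j = f (j + t * K)" if j: "j < K" for j
  proof -
    from g(3)[OF j] obtain t where t: "t < 2 ^ q" "g j = h (j + t * K)" by blast
    from h(3)[of "j + t * K"] show ?thesis
    proof
      assume "h (j + t * K) = f (j + t * K)"
      with t show ?thesis by (intro exI[of _ t]) auto
    next
      assume "h (j + t * K) = f (j + t * K + n)"
      with t show ?thesis by (intro exI[of _ "t + 2 ^ q"]) (auto simp: n_def algebra_simps)
    qed
  qed
  ultimately show ?case by blast
qed

lemma hidden_eval_reduction_Max:
  assumes "K > 0" "\<And>i. i < 2 ^ q * K \<Longrightarrow> f i \<ge> 0"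
  shows "hidden_eval (reduction 1 K q) (vec (2 ^ q * K) f) =
    vec K (\<lambda>j. MAX t\<in>{..<2 ^ q}. f (j + t * K))"
proof -
  obtain g where g: "hidden_eval (reduction 1 K q) (vec (2 ^ q * K) f) = vec K g"
      "\<forall>j<K. (\<forall>t<2 ^ q. f (j + t * K) \<le> g j) \<and> (\<exists>t<2 ^ q. g j = f (j + t * K))"
    using hidden_eval_reduction[of 1 K q f] assms by auto
  have "(MAX t\<in>{..<2 ^ q}. f (j + t * K)) = g j" if "j < K" for j
    by (rule Max_eqI) (use g(2) that in auto)
  with g(1) show ?thesis by auto
qed

lemma hidden_eval_reduction_Min:
  assumes "K > 0" "\<And>i. i < 2 ^ q * K \<Longrightarrow> f i \<ge> 0"
  shows "hidden_eval (reduction (-1) K q) (vec (2 ^ q * K) f) =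
    vec K (\<lambda>j. MIN t\<in>{..<2 ^ q}. f (j + t * K))"
proof -
  obtain g where g: "hidden_eval (reduction (-1) K q) (vec (2 ^ q * K) f) = vec K g"
      "\<forall>j<K. (\<forall>t<2 ^ q. g j \<le> f (j + t * K)) \<and> (\<exists>t<2 ^ q. g j = f (j + t * K))"
    using hidden_eval_reduction[of "-1" K q f] assms by auto
  have "(MIN t\<in>{..<2 ^ q}. f (j + t * K)) = g j" if "j < K" for j
    by (rule Min_eqI) (use g(2) that in auto)
  with g(1) show ?thesis by auto
qed

lemma hidden_fits_reduction: "K > 0 \<Longrightarrow> hidden_fits (2 ^ q * K) (reduction \<sigma> K q) K"
proof (induction q)
  case (Suc q)
  then have "hidden_fits (2 ^ Suc q * K) (halving_level \<sigma> (2 ^ q * K)) (2 ^ q * K)"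
    by (simp add: halving_level_def)
  with Suc show ?case by (auto intro: hidden_fits_append)
qed simp

lemma length_reduction: "length (reduction \<sigma> K q) = 2 * q"
  by (induction q) (simp_all add: halving_level_def)

lemma dims_reduction:
  "(A, b) \<in> set (reduction \<sigma> K q) \<Longrightarrow> dim_row A \<le> 2 ^ q * K \<and> dim_col A \<le> 2 ^ q * K"
  by (induction q) (auto simp: halving_level_def)

text \<open>A level with \<open>2 * n\<close> inputs costs at most \<open>6 * n\<close>. The widths
  halve from level to level, so the costs sum geometrically.\<close>

lemma nonzero_params_reduction: "mlp_nonzero_params (reduction \<sigma> K q) \<le> 6 * (2 ^ q * K)"
proof (induction q)
  case (Suc q)
  define n where "n = 2 ^ q * K"
  have "mlp_nonzero_params (halving_level \<sigma> n) =
      mlp_nonzero_params [(pair_mat (2 * n) n (\<lambda>i. if i < n then \<sigma> else 1) (\<lambda>i. - \<sigma>), 0\<^sub>v (2 * n))] +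
      mlp_nonzero_params [(pair_mat n n (\<lambda>i. \<sigma>) (\<lambda>i. 1), 0\<^sub>v n)]"
    by (simp add: halving_level_def mlp_nonzero_params_def)
  also have "\<dots> \<le> 2 * (2 * n) + 2 * n"
    by (intro add_mono nonzero_params_pair_mat)
  finally show ?case
    using Suc by (simp add: n_def algebra_simps)
qed simp

text \<open>One layer computes all affine functions, two reductions take the minima and then the
  maximum, and the output layer adds \<open>c\<close> as its bias. The inner \<open>max 0\<close> is
  the ReLU of the first layer and supplies the nonnegativity that the reductions require.\<close>

lemma max_min_affine_mlp:
  fixes w :: "nat \<Rightarrow> nat \<Rightarrow> real vec" and \<beta> :: "nat \<Rightarrow> nat \<Rightarrow> real"
  assumes w: "\<And>k t. k < 2 ^ m \<Longrightarrow> t < 2 ^ q \<Longrightarrow> w k t \<in> carrier_vec d"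
  shows "\<exists>\<Phi>. is_mlp d 1 \<Phi> \<and> mlp_depth \<Phi> = 2 * q + 2 * m + 2 \<and>
    mlp_width \<Phi> \<le> d + 2 ^ q * 2 ^ m \<and>
    mlp_nonzero_params \<Phi> \<le> 2 ^ q * 2 ^ m * (d + 13) + 2 \<and>
    (\<forall>x\<in>carrier_vec d. mlp_fun \<Phi> x =
      c + (MAX k\<in>{..<2 ^ m}. MIN t\<in>{..<2 ^ q}. max 0 (w k t \<bullet> x + \<beta> k t)))"
proof -
  define M :: nat where "M = 2 ^ m"
  define n where "n = 2 ^ q * M"
  have M: "M > 0" by (simp add: M_def)
  have n: "n > 0" by (simp add: n_def M)
  have "M \<le> n" by (simp add: n_def)
  \<comment> \<open>Neuron \<open>i = k + t * M\<close> carries the pair \<open>(k, t)\<close>, so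
    that reducing with block length \<open>M\<close> takes the minimum over \<open>t\<close> for
    every \<open>k\<close>.\<close>
  define A where "A = mat n d (\<lambda>(i, j). w (i mod M) (i div M) $ j)"
  define b where "b = vec n (\<lambda>i. \<beta> (i mod M) (i div M))"
  define hs where "hs = (A, b) # reduction (-1) M q @ reduction 1 1 m"
  define \<Phi> where "\<Phi> = hs @ [(1\<^sub>m 1, vec 1 (\<lambda>_. c))]"
  have "hidden_fits d hs 1"
    using hidden_fits_reduction[OF M, of q "-1"] hidden_fits_reduction[of 1 m 1] n
    by (auto simp: hs_def A_def b_def n_def M_def intro: hidden_fits_append)
  then have "is_mlp d 1 \<Phi>"
    unfolding \<Phi>_def by (rule is_mlp_append_output) auto
  moreover have "mlp_depth \<Phi> = 2 * q + 2 * m + 2"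
    by (simp add: mlp_depth_def \<Phi>_def hs_def length_reduction)
  moreover have "mlp_width \<Phi> \<le> d + n"
  proof (rule mlp_width_le)
    show "dim_row B \<le> d + n \<and> dim_col B \<le> d + n" if "(B, v) \<in> set \<Phi>" for B v
      using that dims_reduction[of B v "-1" M q] dims_reduction[of B v 1 1 m] \<open>M \<le> n\<close> n
      by (auto simp: \<Phi>_def hs_def A_def n_def[symmetric] M_def[symmetric])
  qed (simp add: \<Phi>_def)
  moreover have "mlp_nonzero_params \<Phi> \<le> n * (d + 13) + 2"
  proof -
    have "mlp_nonzero_params \<Phi> = mlp_nonzero_params [(A, b)] +
        mlp_nonzero_params (reduction (-1) M q) + mlp_nonzero_params (reduction 1 1 m) +
        mlp_nonzero_params [(1\<^sub>m 1, vec 1 (\<lambda>_. c))]"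
      by (simp add: \<Phi>_def hs_def mlp_nonzero_params_def)
    \<comment> \<open>The first layer is counted as dense; since \<open>M \<le> n\<close>, the
      coefficients 1, 6 and 6 add up to 13.\<close>
    also have "\<dots> \<le> (n * d + n) + 6 * n + 6 * M + 2"
    proof (intro add_mono)
      show "mlp_nonzero_params [(A, b)] \<le> n * d + n"
        using mlp_nonzero_params_singleton_le[of A b] by (simp add: A_def b_def)
      show "mlp_nonzero_params (reduction (-1) M q) \<le> 6 * n"
        unfolding n_def by (rule nonzero_params_reduction)
      show "mlp_nonzero_params (reduction 1 1 m) \<le> 6 * M"
        using nonzero_params_reduction[of 1 1 m] by (simp add: M_def)
      show "mlp_nonzero_params [(1\<^sub>m 1, vec 1 (\<lambda>_. c))] \<le> 2"
        using mlp_nonzero_params_singleton_le[of "1\<^sub>m 1" "vec 1 (\<lambda>_. c)"] by simp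
    qed
    also have "\<dots> \<le> n * (d + 13) + 2"
      using \<open>M \<le> n\<close> by (simp add: algebra_simps)
    finally show ?thesis .
  qed
  moreover have "mlp_fun \<Phi> x =
      c + (MAX k\<in>{..<M}. MIN t\<in>{..<2 ^ q}. max 0 (w k t \<bullet> x + \<beta> k t))"
    if x: "x \<in> carrier_vec d" for x
  proof -
    define f where "f i = max 0 (w (i mod M) (i div M) \<bullet> x + \<beta> (i mod M) (i div M))" for i
    define g where "g j = (MIN t\<in>{..<2 ^ q}. f (j + t * M))" for j
    have "row A i \<bullet> x = w (i mod M) (i div M) \<bullet> x" if "i < n" for i
      using x that by (simp add: A_def row_def scalar_prod_def)
    then have 1: "relu (A *\<^sub>v x + b) = vec n f"
      by (intro eq_vecI) (auto simp: relu_def f_def A_def b_def)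
    have "hidden_eval (reduction (-1) M q) (vec n f) = vec M g"
      unfolding g_def n_def by (rule hidden_eval_reduction_Min) (auto simp: M f_def)
    moreover have g: "0 \<le> g j" for j
      unfolding g_def by (subst Min_ge_iff) (auto simp: f_def lessThan_empty_iff)
    \<comment> \<open>Blocks of length 1 make the second reduction a maximum over all
      \<open>2 ^ m\<close> minima.\<close>
    have "hidden_eval (reduction 1 1 m) (vec M g) = vec 1 (\<lambda>j. MAX t\<in>{..<2 ^ m}. g (j + t))"
      using hidden_eval_reduction_Max[of 1 m g] g by (simp add: M_def)
    ultimately have "hidden_eval hs x = vec 1 (\<lambda>j. MAX t\<in>{..<M}. g (j + t))"
      by (simp add: hs_def 1 M_def)
    then have "mlp_fun \<Phi> x = c + (MAX k\<in>{..<M}. g k)"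
      by (simp add: mlp_fun_def \<Phi>_def mlp_eval_append_output scalar_prod_def)
    also have "(MAX k\<in>{..<M}. g k) =
        (MAX k\<in>{..<M}. MIN t\<in>{..<2 ^ q}. max 0 (w k t \<bullet> x + \<beta> k t))"
      by (intro arg_cong[where f = Max] image_cong refl) (simp add: g_def f_def M)
    finally show ?thesis .
  qed
  ultimately show ?thesis
    unfolding n_def M_def by blast
qed

section \<open>Comparison of p-norms\<close>

lemma inv_exponent_real: "r \<noteq> 0 \<Longrightarrow> inv_exponent (ereal r) = 1 / r"
  by (simp add: inv_exponent_def one_ereal_def ereal_divide)

lemma pnorm_infinity: "pnorm \<infinity> v = Max ((\<lambda>i. \<bar>v $ i\<bar>) ` {..<dim_vec v})"
  by (simp add: pnorm_def)

lemma pnorm_real: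
  "pnorm (ereal r) v = (\<Sum>i<dim_vec v. \<bar>v $ i\<bar> powr r) powr (1 / r)" if "r \<noteq> 0"
  using that by (simp add: pnorm_def inv_exponent_real)

lemma inv_exponent_infinity: "inv_exponent \<infinity> = 0"
  by (simp add: inv_exponent_def)

lemma ereal_ge_1_cases:
  assumes "1 \<le> (p :: ereal)"
  obtains (real) r where "p = ereal r" "1 \<le> r" | (infinity) "p = \<infinity>"
  using assms by (cases p) auto

text \<open>With \<open>s\<close> the sum of the absolute values, \<open>\<bar>v $ i\<bar> powr r
  \<le> \<bar>v $ i\<bar> * s powr (r - 1)\<close>; summing over \<open>i\<close> gives
  \<open>s powr r\<close>.\<close>

lemma pnorm_le_sum:
  assumes "1 \<le> r"
  shows "pnorm (ereal r) v \<le> (\<Sum>i<dim_vec v. \<bar>v $ i\<bar>)"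
proof -
  define s where "s = (\<Sum>i<dim_vec v. \<bar>v $ i\<bar>)"
  have s: "s \<ge> 0" by (simp add: s_def sum_nonneg)
  have "(\<Sum>i<dim_vec v. \<bar>v $ i\<bar> powr r) \<le> (\<Sum>i<dim_vec v. \<bar>v $ i\<bar> * s powr (r - 1))"
  proof (rule sum_mono)
    fix i assume "i \<in> {..<dim_vec v}"
    then have "\<bar>v $ i\<bar> \<le> s"
      unfolding s_def by (intro member_le_sum) auto
    moreover have "\<bar>v $ i\<bar> powr r = \<bar>v $ i\<bar> * \<bar>v $ i\<bar> powr (r - 1)"
      using powr_mult_base[of "\<bar>v $ i\<bar>" "r - 1"] by simp
    ultimately show "\<bar>v $ i\<bar> powr r \<le> \<bar>v $ i\<bar> * s powr (r - 1)"
      using assms by (simp add: mult_left_mono powr_mono2)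
  qed
  also have "\<dots> = s powr r"
    using s powr_mult_base[of s "r - 1"] by (simp add: s_def sum_distrib_right)
  finally have "(\<Sum>i<dim_vec v. \<bar>v $ i\<bar> powr r) powr (1 / r) \<le> (s powr r) powr (1 / r)"
    using assms by (intro powr_mono2) (auto intro: sum_nonneg)
  with assms s show ?thesis
    by (simp add: pnorm_real powr_powr s_def)
qed

text \<open>The bounds \<open>ln t \<ge> 1 - 1 / t\<close> and \<open>exp y \<ge> 1 + y\<close>
  estimate \<open>t powr (r - 1)\<close> from below; multiplying by \<open>t\<close> gives the
  claim.\<close>

lemma Bernoulli_powr:
  fixes t r :: real
  assumes "t \<ge> 0" "r \<ge> 1"
  shows "1 + r * (t - 1) \<le> t powr r"
proof (cases "t = 0")
  case False
  with assms have t: "t > 0" by simp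
  have "(r - 1) * (1 - 1 / t) \<le> (r - 1) * ln t"
    using ln_le_minus_one[of "1 / t"] t assms by (intro mult_left_mono) (auto simp: ln_div)
  also have "1 + (r - 1) * ln t \<le> exp ((r - 1) * ln t)"
    by (rule exp_ge_add_one_self)
  finally have "t * (1 + (r - 1) * (1 - 1 / t)) \<le> t * t powr (r - 1)"
    using t by (intro mult_left_mono) (auto simp: powr_def)
  also have "\<dots> = t powr r"
    using t by (simp add: powr_mult_base)
  also have "t * (1 + (r - 1) * (1 - 1 / t)) = 1 + r * (t - 1)"
    using t by (simp add: field_simps)
  finally show ?thesis .
qed (use assms in auto)

text \<open>Hoelder's inequality against a constant vector, obtained by summing Bernoulli's
  inequality over the entries.\<close>

lemma sum_le_pnorm:
  assumes "1 \<le> r" "dim_vec v > 0"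
  shows "(\<Sum>i<dim_vec v. \<bar>v $ i\<bar>) \<le> real (dim_vec v) powr (1 - 1 / r) * pnorm (ereal r) v"
proof -
  define s where "s = (\<Sum>i<dim_vec v. \<bar>v $ i\<bar>)"
  define n where "n = real (dim_vec v)"
  define S where "S = (\<Sum>i<dim_vec v. \<bar>v $ i\<bar> powr r)"
  have n: "n > 0" using assms by (simp add: n_def)
  have s: "s \<ge> 0" by (simp add: s_def sum_nonneg)
  have S: "S \<ge> 0" by (simp add: S_def sum_nonneg)
  have "s \<le> n powr (1 - 1 / r) * S powr (1 / r)"
  proof (cases "s = 0")
    case False
    with s have "s > 0" by simp
    \<comment> \<open>The numbers \<open>\<bar>v $ i\<bar> * n / s\<close> have mean 1, so the
      linear terms cancel in the sum.\<close>
    have "n = (\<Sum>i<dim_vec v. 1 + r * (\<bar>v $ i\<bar> * n / s - 1))"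
      using \<open>s > 0\<close>
      by (simp add: sum.distrib sum_subtractf algebra_simps flip: sum_distrib_left sum_distrib_right
          sum_divide_distrib s_def n_def)
    also have "\<dots> \<le> (\<Sum>i<dim_vec v. (\<bar>v $ i\<bar> * n / s) powr r)"
      using n s assms by (intro sum_mono Bernoulli_powr) auto
    also have "\<dots> = (n / s) powr r * S"
      using n \<open>s > 0\<close> by (simp add: S_def sum_distrib_left powr_mult powr_divide mult.commute)
    finally have "n powr (1 / r) \<le> ((n / s) powr r * S) powr (1 / r)"
      using n assms by (intro powr_mono2) auto
    also have "\<dots> = n / s * S powr (1 / r)"
      using n \<open>s > 0\<close> S assms by (simp add: powr_mult powr_powr)
    finally have "s * n powr (1 / r) \<le> n * S powr (1 / r)"
      using \<open>s > 0\<close> by (simp add: field_simps)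
    then show ?thesis
      using n by (simp add: powr_diff field_simps)
  qed simp
  with assms show ?thesis
    by (simp add: pnorm_real s_def n_def S_def)
qed

lemma abs_le_pnorm:
  assumes "1 \<le> p" "i < dim_vec v"
  shows "\<bar>v $ i\<bar> \<le> pnorm p v"
  using assms(1)
proof (cases p rule: ereal_ge_1_cases)
  case (real r)
  have "\<bar>v $ i\<bar> powr r \<le> (\<Sum>i<dim_vec v. \<bar>v $ i\<bar> powr r)"
    by (rule member_le_sum) (use assms in auto)
  then have "(\<bar>v $ i\<bar> powr r) powr (1 / r) \<le> (\<Sum>i<dim_vec v. \<bar>v $ i\<bar> powr r) powr (1 / r)"
    using real by (intro powr_mono2) auto
  with real show ?thesis
    by (simp add: powr_powr pnorm_real)
next
  case infinity
  with assms show ?thesis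
    by (auto simp: pnorm_infinity intro!: Max_ge)
qed

lemma pnorm_le_bound:
  assumes "1 \<le> p" "dim_vec v > 0" "\<And>i. i < dim_vec v \<Longrightarrow> \<bar>v $ i\<bar> \<le> B"
  shows "pnorm p v \<le> real (dim_vec v) powr inv_exponent p * B"
  using assms(1)
proof (cases p rule: ereal_ge_1_cases)
  case (real r)
  have "B \<ge> 0" using assms(2) assms(3)[of 0] by linarith
  have "(\<Sum>i<dim_vec v. \<bar>v $ i\<bar> powr r) \<le> (\<Sum>i<dim_vec v. B powr r)"
    by (intro sum_mono powr_mono2) (use assms real in auto)
  then have "(\<Sum>i<dim_vec v. \<bar>v $ i\<bar> powr r) powr (1 / r) \<le> (dim_vec v * B powr r) powr (1 / r)"
    using real by (intro powr_mono2) (auto intro: sum_nonneg)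
  with real \<open>B \<ge> 0\<close> show ?thesis
    by (simp add: powr_mult powr_powr pnorm_real inv_exponent_real)
next
  case infinity
  have "Max ((\<lambda>i. \<bar>v $ i\<bar>) ` {..<dim_vec v}) \<le> B"
    by (rule Max.boundedI) (use assms in \<open>auto simp: lessThan_empty_iff\<close>)
  \<comment> \<open>\<open>0 powr 0\<close> is 0, so the positive dimension matters here.\<close>
  moreover have "real (dim_vec v) powr inv_exponent p = 1"
    unfolding infinity inv_exponent_infinity using assms(2)
    by (metis less_irrefl of_nat_0_less_iff powr_zero_eq_one)
  ultimately show ?thesis
    using infinity by (simp add: pnorm_infinity)
qed

section \<open>Approximation by a maximum of cones\<close>

lemma ex_enumeration:
  assumes "finite S" "S \<noteq> {}" "card S \<le> n"
  shows "\<exists>e. e ` {..<n} = S"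
proof -
  obtain g where g: "bij_betw g {..<card S} S"
    using ex_bij_betw_nat_finite[OF assms(1)] by (auto simp: atLeast0LessThan)
  then have im: "g ` {..<card S} = S" by (simp add: bij_betw_def)
  \<comment> \<open>Indices beyond the cardinality repeat \<open>g 0\<close>. This padding fills all
    slots of a binary tree without changing maxima or minima.\<close>
  define e where "e k = g (if k < card S then k else 0)" for k
  have "g (if k < card S then k else 0) \<in> g ` {..<card S}" for k
    by (rule imageI) (use assms in \<open>auto simp: card_gt_0_iff\<close>)
  then have "e ` {..<n} \<subseteq> S"
    by (auto simp: e_def im)
  moreover have "S \<subseteq> e ` {..<n}"
  proof
    fix s assume "s \<in> S"
    with im obtain k where "k < card S" "s = g k" by auto
    with assms(3) show "s \<in> e ` {..<n}"
      by (intro image_eqI[of _ _ k]) (auto simp: e_def)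
  qed
  ultimately show ?thesis by blast
qed

text \<open>A one-sided bound, proved for arbitrary pairs and used in both orders. It transfers
  Lipschitz bounds from single pieces to their maximum.\<close>

lemma abs_Max_diff_le:
  fixes f g :: "'a \<Rightarrow> real"
  assumes "finite I" "I \<noteq> {}" "\<And>i. i \<in> I \<Longrightarrow> \<bar>f i - g i\<bar> \<le> e"
  shows "\<bar>Max (f ` I) - Max (g ` I)\<bar> \<le> e"
proof -
  have "Max (f ` I) \<le> Max (g ` I) + e" if "\<And>i. i \<in> I \<Longrightarrow> \<bar>f i - g i\<bar> \<le> e" for f g :: "'a \<Rightarrow> real"
  proof (rule Max.boundedI)
    fix y assume "y \<in> f ` I"
    then obtain i where "i \<in> I" "y = f i" by auto
    moreover from this have "g i \<le> Max (g ` I)" using assms(1) by simp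
    ultimately show "y \<le> Max (g ` I) + e" using that[of i] by linarith
  qed (use assms in auto)
  from this[of f g] this[of g f] assms(3) show ?thesis
    by (fastforce simp: abs_minus_commute)
qed

lemma abs_Min_diff_le:
  fixes f g :: "'a \<Rightarrow> real"
  assumes "finite I" "I \<noteq> {}" "\<And>i. i \<in> I \<Longrightarrow> \<bar>f i - g i\<bar> \<le> e"
  shows "\<bar>Min (f ` I) - Min (g ` I)\<bar> \<le> e"
proof -
  have "Min (f ` I) - e \<le> Min (g ` I)" if "\<And>i. i \<in> I \<Longrightarrow> \<bar>f i - g i\<bar> \<le> e" for f g :: "'a \<Rightarrow> real"
  proof (rule Min.boundedI)
    fix y assume "y \<in> g ` I"
    then obtain i where "i \<in> I" "y = g i" by auto
    moreover from this have "Min (f ` I) \<le> f i" using assms(1) by simp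
    ultimately show "Min (f ` I) - e \<le> y" using that[of i] by linarith
  qed (use assms in auto)
  from this[of f g] this[of g f] assms(3) show ?thesis
    by (fastforce simp: abs_minus_commute)
qed

section \<open>Centres of the grid cells\<close>

definition cell_centres :: "nat \<Rightarrow> nat \<Rightarrow> real vec set" where
  "cell_centres d M =
     (\<lambda>h. vec d (\<lambda>i. (real (h i) + 1 / 2) / real M)) ` ({..<d} \<rightarrow>\<^sub>E {..<M})"

lemma finite_cell_centres: "finite (cell_centres d M)"
  by (simp add: cell_centres_def finite_PiE)

lemma cell_centres_nonempty: "M > 0 \<Longrightarrow> cell_centres d M \<noteq> {}"
  by (simp add: cell_centres_def PiE_eq_empty_iff lessThan_empty_iff)

lemma card_cell_centres_le: "card (cell_centres d M) \<le> M ^ d"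
proof -
  have "card (cell_centres d M) \<le> card ({..<d} \<rightarrow>\<^sub>E {..<M})"
    unfolding cell_centres_def by (rule card_image_le) (simp add: finite_PiE)
  then show ?thesis by (simp add: card_PiE)
qed

lemma cell_centres_subset: "cell_centres d M \<subseteq> unit_cube d"
proof
  fix c assume "c \<in> cell_centres d M"
  then obtain h where h: "h \<in> {..<d} \<rightarrow>\<^sub>E {..<M}"
      and c: "c = vec d (\<lambda>i. (real (h i) + 1 / 2) / real M)"
    by (auto simp: cell_centres_def)
  have "0 \<le> c $ i \<and> c $ i \<le> 1" if "i < d" for i
  proof -
    from h that have "h i < M" by auto
    then have "real (h i) + 1 / 2 \<le> real M" by linarith
    with that \<open>h i < M\<close> show ?thesis by (simp add: c divide_simps)
  qed
  then show "c \<in> unit_cube d" by (simp add: unit_cube_def c)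
qed

text \<open>Each coordinate is rounded down to a cell of side \<open>1 / M\<close>, whose centre is
  at most half a side away.\<close>

lemma near_cell_centre:
  assumes "M > 0" "x \<in> unit_cube d"
  obtains c where "c \<in> cell_centres d M" "\<And>i. i < d \<Longrightarrow> \<bar>x $ i - c $ i\<bar> \<le> 1 / (2 * real M)"
proof -
  have "\<exists>k<M. \<bar>x $ i - (real k + 1 / 2) / real M\<bar> \<le> 1 / (2 * real M)" if "i < d" for i
  proof -
    from assms that have x: "0 \<le> x $ i" "x $ i \<le> 1" by (auto simp: unit_cube_def)
    define l where "l = nat \<lfloor>real M * (x $ i)\<rfloor>"
    have l: "real l \<le> real M * (x $ i)" "real M * (x $ i) < real l + 1"
      using x by (simp_all add: l_def)
    \<comment> \<open>The cap at \<open>M - 1\<close> places a coordinate equal to 1 in the last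
      cell.\<close>
    define k where "k = min (M - 1) l"
    have "k < M" using assms by (simp add: k_def)
    have "real M * (x $ i) \<le> real M" using x by (simp add: mult_left_le)
    then have "real k \<le> real M * (x $ i) \<and> real M * (x $ i) \<le> real k + 1"
      using l assms by (cases "l < M") (auto simp: k_def min_def of_nat_diff)
    then have "\<bar>real M * (x $ i) - (real k + 1 / 2)\<bar> \<le> 1 / 2"
      by linarith
    moreover have "x $ i - (real k + 1 / 2) / real M = (real M * (x $ i) - (real k + 1 / 2)) / real M"
      using assms by (simp add: field_simps)
    ultimately have "\<bar>x $ i - (real k + 1 / 2) / real M\<bar> \<le> 1 / (2 * real M)"
      using assms by (simp add: divide_simps mult_ac)
    with \<open>k < M\<close> show ?thesis by blast
  qed
  then obtain h where h: "\<And>i. i < d \<Longrightarrow> h i < M"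
      "\<And>i. i < d \<Longrightarrow> \<bar>x $ i - (real (h i) + 1 / 2) / real M\<bar> \<le> 1 / (2 * real M)"
    by metis
  show thesis
  proof
    \<comment> \<open>Restriction makes \<open>h\<close> extensional, as the index set of
      \<open>cell_centres\<close> demands.\<close>
    show "vec d (\<lambda>i. (real (restrict h {..<d} i) + 1 / 2) / real M) \<in> cell_centres d M"
      unfolding cell_centres_def by (rule imageI) (use h in \<open>auto split: if_splits\<close>)
  qed (use h in simp)
qed

text \<open>Since \<open>\<nu>\<close> is the maximum of the functionals in \<open>S\<close>, each
  cone \<open>f (z k) - \<Lambda> * \<nu> (x - z k)\<close> is a minimum of affine functions.
  \<open>C\<close> compares \<open>\<nu>\<close> with the maximum norm.
  \<open>\<Lambda> * \<nu>\<close> lies between \<open>L\<close> and \<open>K\<close> times the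
  p-norm: the lower side controls the error, the upper side the Lipschitz constant.\<close>

lemma max_min_cone_approximation:
  fixes S :: "real vec set" and \<nu> :: "real vec \<Rightarrow> real"
  assumes d: "d > 0" and p: "1 \<le> p"
    and S: "S \<subseteq> carrier_vec d" "card S \<le> 2 ^ d" "finite S"
    and \<nu>: "\<And>v s. v \<in> carrier_vec d \<Longrightarrow> s \<in> S \<Longrightarrow> \<bar>s \<bullet> v\<bar> \<le> \<nu> v"
      "\<And>v. v \<in> carrier_vec d \<Longrightarrow> \<exists>s\<in>S. s \<bullet> v = \<nu> v"
    and \<nu>_bound: "\<And>v r. v \<in> carrier_vec d \<Longrightarrow> (\<And>i. i < d \<Longrightarrow> \<bar>v $ i\<bar> \<le> r) \<Longrightarrow> \<nu> v \<le> C * r"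
    and \<Lambda>: "0 \<le> \<Lambda>" "\<And>v. v \<in> carrier_vec d \<Longrightarrow> L * pnorm p v \<le> \<Lambda> * \<nu> v"
    and K: "0 \<le> K" "\<And>v. v \<in> carrier_vec d \<Longrightarrow> \<Lambda> * \<nu> v \<le> K * pnorm p v"
    and f: "lipschitz_pnorm p L (unit_cube d) f"
  shows "\<exists>\<Phi>. is_mlp d 1 \<Phi> \<and> mlp_depth \<Phi> = 2 * d + 2 * (a * d) + 2 \<and>
    mlp_width \<Phi> \<le> d + 2 ^ d * 2 ^ (a * d) \<and>
    mlp_nonzero_params \<Phi> \<le> 2 ^ d * 2 ^ (a * d) * (d + 13) + 2 \<and>
    (\<forall>x\<in>unit_cube d. \<bar>f x - mlp_fun \<Phi> x\<bar> \<le> \<Lambda> * C / 2 ^ a) \<and>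
    lipschitz_pnorm p K (carrier_vec d) (mlp_fun \<Phi>)"
proof -
  define G where "G = cell_centres d (2 ^ a)"
  have G: "finite G" "G \<noteq> {}" "G \<subseteq> unit_cube d" "card G \<le> 2 ^ (a * d)"
    using card_cell_centres_le[of d "2 ^ a"]
    by (auto simp: G_def finite_cell_centres cell_centres_nonempty cell_centres_subset power_mult
        intro: cell_centres_subset[THEN subsetD])
  from \<nu>(2)[of "0\<^sub>v d"] have "S \<noteq> {}" by auto
  obtain z :: "nat \<Rightarrow> real vec" where z: "z ` {..<2 ^ (a * d)} = G"
    using ex_enumeration[OF G(1,2,4)] by blast
  obtain s :: "nat \<Rightarrow> real vec" where s: "s ` {..<2 ^ d} = S"
    using ex_enumeration[OF S(3) \<open>S \<noteq> {}\<close> S(2)] by blast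
  \<comment> \<open>Subtracting the least sampled value before the ReLU truncates the cones from
    below at \<open>c\<close>, a level that exceeds \<open>f\<close> by at most half of the error
    bound.\<close>
  define c where "c = Min (f ` G)"
  define u where "u k t x = max 0 (f (z k) - c - \<Lambda> * (s t \<bullet> (x - z k)))" for k t x
  define F where "F x = c + (MAX k\<in>{..<2 ^ (a * d)}. MIN t\<in>{..<2 ^ d}. u k t x)" for x
  have zc: "z k \<in> carrier_vec d" "z k \<in> unit_cube d" if "k < 2 ^ (a * d)" for k
    using z G(3) that by (auto simp: unit_cube_def)
  have sc: "s t \<in> carrier_vec d" "s t \<in> S" if "t < 2 ^ d" for t
    using s S(1) that by auto
  have wc: "(- \<Lambda>) \<cdot>\<^sub>v s t \<in> carrier_vec d" if "k < 2 ^ (a * d)" "t < 2 ^ d" for k t :: nat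
    using sc that by simp
  obtain \<Phi> where \<Phi>: "is_mlp d 1 \<Phi>" "mlp_depth \<Phi> = 2 * d + 2 * (a * d) + 2"
      "mlp_width \<Phi> \<le> d + 2 ^ d * 2 ^ (a * d)"
      "mlp_nonzero_params \<Phi> \<le> 2 ^ d * 2 ^ (a * d) * (d + 13) + 2"
      "\<And>x. x \<in> carrier_vec d \<Longrightarrow> mlp_fun \<Phi> x =
        c + (MAX k\<in>{..<2 ^ (a * d)}. MIN t\<in>{..<2 ^ d}.
          max 0 (((- \<Lambda>) \<cdot>\<^sub>v s t) \<bullet> x + (f (z k) - c + \<Lambda> * (s t \<bullet> z k))))"
    using max_min_affine_mlp[of "a * d" d "\<lambda>k t. (- \<Lambda>) \<cdot>\<^sub>v s t" d c
        "\<lambda>k t. f (z k) - c + \<Lambda> * (s t \<bullet> z k)"] wc by blast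
  have \<Phi>_F: "mlp_fun \<Phi> x = F x" if "x \<in> carrier_vec d" for x
  proof -
    have "max 0 (((- \<Lambda>) \<cdot>\<^sub>v s t) \<bullet> x + (f (z k) - c + \<Lambda> * (s t \<bullet> z k))) = u k t x"
      if "k < 2 ^ (a * d)" "t < 2 ^ d" for k t
      using sc[OF that(2)] zc[OF that(1)] \<open>x \<in> carrier_vec d\<close>
      by (simp add: u_def scalar_prod_minus_distrib algebra_simps)
    then show ?thesis
      unfolding \<Phi>(5)[OF that] F_def
      by (intro arg_cong[of _ _ "\<lambda>y. c + y"] arg_cong[of _ _ Max] arg_cong[of _ _ Min] image_cong) auto
  qed
  have "\<bar>F x - F y\<bar> \<le> K * pnorm p (x - y)" if xy: "x \<in> carrier_vec d" "y \<in> carrier_vec d" for x y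
  proof -
    have "\<bar>u k t x - u k t y\<bar> \<le> \<Lambda> * \<nu> (x - y)" if "k < 2 ^ (a * d)" "t < 2 ^ d" for k t
    proof -
      have "\<bar>u k t x - u k t y\<bar> \<le> \<bar>\<Lambda> * (s t \<bullet> (x - z k)) - \<Lambda> * (s t \<bullet> (y - z k))\<bar>"
        by (simp add: u_def)
      also have "\<dots> = \<bar>\<Lambda> * (s t \<bullet> (x - y))\<bar>"
        using sc[OF that(2)] zc[OF that(1)] xy
        by (simp add: scalar_prod_minus_distrib algebra_simps)
      also have "\<dots> \<le> \<Lambda> * \<nu> (x - y)"
        using \<Lambda>(1) \<nu>(1)[of "x - y" "s t"] sc[OF that(2)] xy by (simp add: abs_mult mult_left_mono)
      finally show ?thesis .
    qed
    \<comment> \<open>The additive \<open>c\<close> cancels, and neither extremum enlarges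
      differences.\<close>
    then have "\<bar>F x - F y\<bar> \<le> \<Lambda> * \<nu> (x - y)"
      unfolding F_def add_diff_cancel_left
      by (intro abs_Max_diff_le abs_Min_diff_le) (auto simp: lessThan_empty_iff)
    with K(2)[of "x - y"] xy show ?thesis by (simp add: order_trans)
  qed
  then have lip: "lipschitz_pnorm p K (carrier_vec d) (mlp_fun \<Phi>)"
    using K(1) by (simp add: lipschitz_pnorm_def \<Phi>_F)
  have "\<bar>f x - F x\<bar> \<le> \<Lambda> * C / 2 ^ a" if x: "x \<in> unit_cube d" for x
  proof -
    from x have xc: "x \<in> carrier_vec d" by (simp add: unit_cube_def)
    have f_diff: "\<bar>f x - f (z k)\<bar> \<le> \<Lambda> * \<nu> (x - z k)" if "k < 2 ^ (a * d)" for k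
      using f x zc[OF that] xc \<Lambda>(2)[of "x - z k"] unfolding lipschitz_pnorm_def
      by (meson minus_carrier_vec order_trans)
    obtain g where "g \<in> G" "\<And>i. i < d \<Longrightarrow> \<bar>x $ i - g $ i\<bar> \<le> 1 / (2 * real (2 ^ a))"
      using near_cell_centre[OF _ x, of "2 ^ a"] unfolding G_def by auto
    then obtain k\<^sub>0 where k\<^sub>0: "k\<^sub>0 < 2 ^ (a * d)"
        "\<And>i. i < d \<Longrightarrow> \<bar>x $ i - z k\<^sub>0 $ i\<bar> \<le> 1 / (2 * 2 ^ a)"
      using z by auto
    \<comment> \<open>The nearest centre is within half a cell side, \<open>1 / (2 * 2 ^ a)\<close>,
      in each coordinate, so a cone descends by at most \<open>\<epsilon> / 2\<close> on the way to
      \<open>x\<close>.\<close>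
    define \<epsilon> where "\<epsilon> = \<Lambda> * C / 2 ^ a"
    have "\<nu> (x - z k\<^sub>0) \<le> C * (1 / (2 * 2 ^ a))"
      by (rule \<nu>_bound) (use k\<^sub>0(2) carrier_vecD[OF zc(1)[OF k\<^sub>0(1)]] xc in auto)
    then have near: "\<Lambda> * \<nu> (x - z k\<^sub>0) \<le> \<epsilon> / 2"
      using mult_left_mono[OF _ \<Lambda>(1)] by (fastforce simp: \<epsilon>_def)
    have c_le: "c \<le> f (z k)" if "k < 2 ^ (a * d)" for k
      unfolding c_def using G(1) z that by (intro Min_le) auto
    \<comment> \<open>With \<open>t\<close> attaining \<open>\<nu> (x - z k)\<close>, an active ReLU
      leaves the cone, which lies below \<open>f x\<close> by the Lipschitz condition; an inactive
      one leaves \<open>c\<close>, and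
      \<open>c \<le> f (z k\<^sub>0) \<le> f x + \<epsilon> / 2\<close>.\<close>
    have "c + (MIN t\<in>{..<2 ^ d}. u k t x) \<le> f x + \<epsilon> / 2" if k: "k < 2 ^ (a * d)" for k
    proof -
      obtain t where t: "t < 2 ^ d" "s t \<bullet> (x - z k) = \<nu> (x - z k)"
        using \<nu>(2)[of "x - z k"] zc[OF k] xc s by fastforce
      have "c + (MIN t\<in>{..<2 ^ d}. u k t x) \<le> c + u k t x"
        using t by (intro add_left_mono Min_le) auto
      also have "\<dots> \<le> f x + \<epsilon> / 2"
        using c_le[OF k\<^sub>0(1)] near f_diff[OF k] f_diff[OF k\<^sub>0(1)] \<Lambda>(1) t(2)
          \<nu>(1)[of "x - z k\<^sub>0" "s t"] sc[OF t(1)] zc[OF k\<^sub>0(1)] xc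
          mult_left_mono[of 0 "\<nu> (x - z k\<^sub>0)" \<Lambda>]
        by (auto simp: u_def max_def)
      finally show ?thesis .
    qed
    then have "F x \<le> f x + \<epsilon> / 2"
      unfolding F_def le_diff_eq[symmetric] add.commute[of c]
      by (intro Max.boundedI) (auto simp: lessThan_empty_iff algebra_simps)
    moreover have "f x - \<epsilon> \<le> F x"
    proof -
      \<comment> \<open>The cone at the nearby centre suffices: one half of
        \<open>\<epsilon>\<close> is lost between \<open>f x\<close> and
        \<open>f (z k\<^sub>0)\<close>, the other half on the slope of the cone.\<close>
      have "f x - \<epsilon> - c \<le> (MIN t\<in>{..<2 ^ d}. u k\<^sub>0 t x)"
      proof (rule Min.boundedI)
        fix y assume "y \<in> (\<lambda>t. u k\<^sub>0 t x) ` {..<2 ^ d}"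
        then obtain t where t: "t < 2 ^ d" "y = u k\<^sub>0 t x" by auto
        have "\<Lambda> * (s t \<bullet> (x - z k\<^sub>0)) \<le> \<Lambda> * \<nu> (x - z k\<^sub>0)"
          using \<nu>(1)[of "x - z k\<^sub>0" "s t"] sc[OF t(1)] zc[OF k\<^sub>0(1)] xc \<Lambda>(1)
          by (intro mult_left_mono) auto
        then show "f x - \<epsilon> - c \<le> y"
          using near f_diff[OF k\<^sub>0(1)] by (auto simp: t u_def)
      qed (auto simp: lessThan_empty_iff)
      also have "\<dots> \<le> (MAX k\<in>{..<2 ^ (a * d)}. MIN t\<in>{..<2 ^ d}. u k t x)"
        using k\<^sub>0(1) by (intro Max_ge) auto
      finally show ?thesis by (simp add: F_def)
    qed
    moreover have "\<epsilon> \<ge> 0"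
      using near mult_nonneg_nonneg[OF \<Lambda>(1), of "\<nu> (x - z k\<^sub>0)"] f_diff[OF k\<^sub>0(1)] by linarith
    ultimately show ?thesis unfolding \<epsilon>_def[symmetric] by linarith
  qed
  then have "\<forall>x\<in>unit_cube d. \<bar>f x - mlp_fun \<Phi> x\<bar> \<le> \<Lambda> * C / 2 ^ a"
    by (simp add: \<Phi>_F unit_cube_def)
  with \<Phi>(1-4) lip show ?thesis by blast
qed

section \<open>Cones of the sum norm and of the maximum norm\<close>

lemma abs_scalar_prod_sign_le:
  fixes s v :: "real vec"
  assumes "v \<in> carrier_vec d" "\<And>i. i < d \<Longrightarrow> \<bar>s $ i\<bar> = 1"
  shows "\<bar>s \<bullet> v\<bar> \<le> (\<Sum>i<dim_vec v. \<bar>v $ i\<bar>)"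
proof -
  have "\<bar>s \<bullet> v\<bar> \<le> (\<Sum>i<dim_vec v. \<bar>s $ i * v $ i\<bar>)"
    unfolding scalar_prod_def atLeast0LessThan by (rule sum_abs)
  also have "\<dots> = (\<Sum>i<dim_vec v. \<bar>v $ i\<bar>)"
    using assms by (intro sum.cong) (auto simp: abs_mult)
  finally show ?thesis .
qed

text \<open>The sum norm is the maximum of the \<open>2 ^ d\<close> functionals with coefficients 1
  and -1. It dominates the p-norm, hence \<open>\<Lambda> = L\<close>; it is at most
  \<open>d\<close> times the maximum norm, hence \<open>C = d\<close>; and Hoelder's inequality
  gives the Lipschitz constant.\<close>

lemma approximation_p_le_2:
  assumes d: "d > 0" and p: "1 \<le> p" "p \<le> 2" and L: "L \<ge> 0"
    and f: "lipschitz_pnorm p L (unit_cube d) f"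
  shows "\<exists>\<Phi>. is_mlp d 1 \<Phi> \<and> mlp_depth \<Phi> = 2 * d + 2 * (a * d) + 2 \<and>
    mlp_width \<Phi> \<le> d + 2 ^ d * 2 ^ (a * d) \<and>
    mlp_nonzero_params \<Phi> \<le> 2 ^ d * 2 ^ (a * d) * (d + 13) + 2 \<and>
    (\<forall>x\<in>unit_cube d. \<bar>f x - mlp_fun \<Phi> x\<bar> \<le> L * real d / 2 ^ a) \<and>
    lipschitz_pnorm p (L * real d powr (1 - inv_exponent p)) (carrier_vec d) (mlp_fun \<Phi>)"
proof -
  from p obtain r where r: "p = ereal r" "1 \<le> r"
    by (cases p rule: ereal_ge_1_cases) auto
  define sgn_vec where "sgn_vec A = vec d (\<lambda>i. if i \<in> A then -1 else 1 :: real)" for A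
  define S where "S = sgn_vec ` Pow {..<d}"
  show ?thesis
  proof (rule max_min_cone_approximation[OF d p(1), where S = S and L = L and
        \<nu> = "\<lambda>v. \<Sum>i<dim_vec v. \<bar>v $ i\<bar>"])
    show "card S \<le> 2 ^ d"
      using card_image_le[of "Pow {..<d}" sgn_vec] by (simp add: S_def card_Pow)
    show "\<bar>s \<bullet> v\<bar> \<le> (\<Sum>i<dim_vec v. \<bar>v $ i\<bar>)" if "v \<in> carrier_vec d" "s \<in> S" for v s
      using that by (intro abs_scalar_prod_sign_le[of v d]) (auto simp: S_def sgn_vec_def)
    show "\<exists>s\<in>S. s \<bullet> v = (\<Sum>i<dim_vec v. \<bar>v $ i\<bar>)" if "v \<in> carrier_vec d" for v
    proof
      \<comment> \<open>The sign vector that is negative exactly at the negative entries of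
        \<open>v\<close> turns every term into an absolute value.\<close>
      show "sgn_vec {i. i < d \<and> v $ i < 0} \<in> S" by (auto simp: S_def)
      show "sgn_vec {i. i < d \<and> v $ i < 0} \<bullet> v = (\<Sum>i<dim_vec v. \<bar>v $ i\<bar>)"
        using that by (auto simp: sgn_vec_def scalar_prod_def atLeast0LessThan intro!: sum.cong)
    qed
    show "(\<Sum>i<dim_vec v. \<bar>v $ i\<bar>) \<le> real d * R"
      if "v \<in> carrier_vec d" "\<And>i. i < d \<Longrightarrow> \<bar>v $ i\<bar> \<le> R" for v R
      using that sum_bounded_above[of "{..<d}" "\<lambda>i. \<bar>v $ i\<bar>" R] by simp
    show "L * pnorm p v \<le> L * (\<Sum>i<dim_vec v. \<bar>v $ i\<bar>)" if "v \<in> carrier_vec d" for v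
      unfolding r(1) using L by (intro mult_left_mono pnorm_le_sum r)
    show "L * (\<Sum>i<dim_vec v. \<bar>v $ i\<bar>) \<le> L * real d powr (1 - inv_exponent p) * pnorm p v"
      if "v \<in> carrier_vec d" for v
      using mult_left_mono[OF sum_le_pnorm[OF r(2), of v] L] that d r
      by (simp add: inv_exponent_real mult.assoc)
  qed (use L f in \<open>auto simp: S_def sgn_vec_def\<close>)
qed

text \<open>The maximum norm needs only the \<open>2 * d\<close> functionals given by the entries
  and their negatives. It lies below the p-norm and dominates it up to the factor
  \<open>d powr inv_exponent p\<close>, so that one constant \<open>\<Lambda>\<close> serves for the
  error and for the Lipschitz bound.\<close>

lemma approximation_maxnorm:
  assumes d: "d > 0" and p: "1 \<le> p" and L: "L \<ge> 0"
    and f: "lipschitz_pnorm p L (unit_cube d) f"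
  shows "\<exists>\<Phi>. is_mlp d 1 \<Phi> \<and> mlp_depth \<Phi> = 2 * d + 2 * (a * d) + 2 \<and>
    mlp_width \<Phi> \<le> d + 2 ^ d * 2 ^ (a * d) \<and>
    mlp_nonzero_params \<Phi> \<le> 2 ^ d * 2 ^ (a * d) * (d + 13) + 2 \<and>
    (\<forall>x\<in>unit_cube d. \<bar>f x - mlp_fun \<Phi> x\<bar> \<le> L * real d powr inv_exponent p / 2 ^ a) \<and>
    lipschitz_pnorm p (L * real d powr inv_exponent p) (carrier_vec d) (mlp_fun \<Phi>)"
proof -
  define \<Lambda> where "\<Lambda> = L * real d powr inv_exponent p"
  have \<Lambda>: "\<Lambda> \<ge> 0" using L by (simp add: \<Lambda>_def)
  define S where "S = unit_vec d ` {..<d} \<union> (\<lambda>i. - unit_vec d i :: real vec) ` {..<d}"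
  define \<nu> where "\<nu> v = (MAX i\<in>{..<d}. \<bar>v $ i\<bar>)" for v :: "real vec"
  have \<nu>_ge: "\<bar>v $ i\<bar> \<le> \<nu> v" if "i < d" for v i
    unfolding \<nu>_def using that by (intro Max_ge) auto
  have \<nu>_le: "\<nu> v \<le> R" if "\<And>i. i < d \<Longrightarrow> \<bar>v $ i\<bar> \<le> R" for v R
    unfolding \<nu>_def using that d by (intro Max.boundedI) (auto simp: lessThan_empty_iff)
  have unit: "unit_vec d i \<bullet> v = v $ i" "(- unit_vec d i) \<bullet> v = - (v $ i)"
    if "i < d" "v \<in> carrier_vec d" for i and v :: "real vec"
    using that by simp_all
  \<comment> \<open>For positive \<open>d\<close> the functionals fit into \<open>2 ^ d\<close>
    slots, so both norms share the same size bounds.\<close>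
  have "2 * d \<le> 2 ^ d"
    using d by (induction d rule: nat_induct_non_zero) auto
  have "\<exists>\<Phi>. is_mlp d 1 \<Phi> \<and> mlp_depth \<Phi> = 2 * d + 2 * (a * d) + 2 \<and>
    mlp_width \<Phi> \<le> d + 2 ^ d * 2 ^ (a * d) \<and>
    mlp_nonzero_params \<Phi> \<le> 2 ^ d * 2 ^ (a * d) * (d + 13) + 2 \<and>
    (\<forall>x\<in>unit_cube d. \<bar>f x - mlp_fun \<Phi> x\<bar> \<le> \<Lambda> * 1 / 2 ^ a) \<and>
    lipschitz_pnorm p \<Lambda> (carrier_vec d) (mlp_fun \<Phi>)"
  proof (rule max_min_cone_approximation[OF d p, where S = S and L = L and \<nu> = \<nu>])
    have "card S \<le> card ((unit_vec d :: nat \<Rightarrow> real vec) ` {..<d}) + card ((\<lambda>i. - unit_vec d i :: real vec) ` {..<d})"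
      unfolding S_def by (rule card_Un_le)
    also have "\<dots> \<le> d + d"
      by (intro add_mono order_trans[OF card_image_le]) auto
    finally show "card S \<le> 2 ^ d"
      using \<open>2 * d \<le> 2 ^ d\<close> by linarith
    show "\<bar>s \<bullet> v\<bar> \<le> \<nu> v" if "v \<in> carrier_vec d" "s \<in> S" for v s
      using that \<nu>_ge unit by (auto simp: S_def)
    show "\<exists>s\<in>S. s \<bullet> v = \<nu> v" if v: "v \<in> carrier_vec d" for v
    proof -
      have "\<nu> v \<in> (\<lambda>i. \<bar>v $ i\<bar>) ` {..<d}"
        unfolding \<nu>_def using d by (intro Max_in) (auto simp: lessThan_empty_iff)
      then obtain i where i: "i < d" "\<nu> v = \<bar>v $ i\<bar>" by auto
      then show ?thesis
        using unit[OF i(1) v] by (intro bexI[of _ "if v $ i < 0 then - unit_vec d i else unit_vec d i"])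
          (auto simp: S_def)
    qed
    show "\<nu> v \<le> 1 * R" if "\<And>i. i < d \<Longrightarrow> \<bar>v $ i\<bar> \<le> R" for v R
      using \<nu>_le[OF that] by simp
    show "L * pnorm p v \<le> \<Lambda> * \<nu> v" if "v \<in> carrier_vec d" for v
      using mult_left_mono[OF pnorm_le_bound[OF p, of v "\<nu> v"] L] that d \<nu>_ge
      by (simp add: \<Lambda>_def mult.assoc)
    show "\<Lambda> * \<nu> v \<le> \<Lambda> * pnorm p v" if "v \<in> carrier_vec d" for v
      using that p by (intro mult_left_mono \<nu>_le abs_le_pnorm \<Lambda>) auto
  qed (use \<Lambda> f in \<open>auto simp: S_def\<close>)
  then show ?thesis by (simp add: \<Lambda>_def)
qed

section \<open>Case distinction at exponent 2 and choice of the grid scale\<close>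

lemma inv_exponent_ge_half:
  assumes "1 \<le> p" "p \<le> 2"
  shows "1 / 2 \<le> inv_exponent p"
proof -
  from assms obtain r where "p = ereal r" "1 \<le> r" "r \<le> 2"
    by (cases p rule: ereal_ge_1_cases) auto
  then show ?thesis by (simp add: inv_exponent_real field_simps)
qed

lemma inv_exponent_le_half:
  assumes "p > 2"
  shows "inv_exponent p \<le> 1 / 2"
proof (cases p)
  case (real r)
  with assms have "r > 2" by simp
  with real show ?thesis by (simp add: inv_exponent_real field_simps)
qed (use assms in \<open>auto simp: inv_exponent_infinity\<close>)

text \<open>\<open>inv_exponent p\<close> is at least 1/2 for \<open>p \<le> 2\<close> and at most
  1/2 for larger \<open>p\<close>. Hence the sum norm in the first case and the maximum norm in the
  second attain the minimum in the exponent of \<open>d\<close>.\<close>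

lemma approximation_dyadic:
  assumes "d > 0" "1 \<le> p" "L \<ge> 0" "lipschitz_pnorm p L (unit_cube d) f"
  shows "\<exists>\<Phi>. is_mlp d 1 \<Phi> \<and> mlp_depth \<Phi> = 2 * d + 2 * (a * d) + 2 \<and>
    mlp_width \<Phi> \<le> d + 2 ^ d * 2 ^ (a * d) \<and>
    mlp_nonzero_params \<Phi> \<le> 2 ^ d * 2 ^ (a * d) * (d + 13) + 2 \<and>
    (\<forall>x\<in>unit_cube d. \<bar>f x - mlp_fun \<Phi> x\<bar> \<le> approx_const p d * L / 2 ^ a) \<and>
    lipschitz_pnorm p (L * real d powr min (inv_exponent p) (1 - inv_exponent p))
      (carrier_vec d) (mlp_fun \<Phi>)"
proof (cases "p \<le> 2")
  case True
  with inv_exponent_ge_half[of p] assms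
  have "min (inv_exponent p) (1 - inv_exponent p) = 1 - inv_exponent p" by simp
  with approximation_p_le_2[OF assms(1,2) True assms(3,4), of a] True show ?thesis
    by (simp add: approx_const_def mult.commute)
next
  case False
  then have "inv_exponent p \<le> 1 / 2"
    by (intro inv_exponent_le_half) simp
  then have "min (inv_exponent p) (1 - inv_exponent p) = inv_exponent p" by simp
  with approximation_maxnorm[OF assms, of a] False show ?thesis
    by (simp add: approx_const_def mult.commute)
qed

text \<open>The predecessor of the least \<open>a\<close> with \<open>N \<le> 2 ^ (a * d)\<close>
  violates this bound, so the overshoot is at most a factor \<open>2 ^ d\<close>.\<close>

lemma ex_dyadic_scale:
  assumes "d > 0" "N \<ge> (2 :: nat)"
  obtains a where "N \<le> 2 ^ (a * d)" "2 ^ (a * d) \<le> 2 ^ d * N"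
proof -
  define a where "a = (LEAST a. N \<le> 2 ^ (a * d))"
  have "N \<le> 2 ^ N" using less_exp[of N] by simp
  also have "\<dots> \<le> 2 ^ (N * d)" using assms by (intro power_increasing) auto
  finally have "N \<le> 2 ^ (N * d)" .
  then have a: "N \<le> 2 ^ (a * d)"
    unfolding a_def by (rule LeastI)
  \<comment> \<open>\<open>a = 0\<close> would give \<open>N \<le> 1\<close>, so a predecessor
    exists.\<close>
  with assms obtain b where b: "a = Suc b" by (cases a) auto
  then have "\<not> N \<le> 2 ^ (b * d)"
    using not_less_Least[of b "\<lambda>a. N \<le> 2 ^ (a * d)"] by (simp add: a_def)
  then have "2 ^ (a * d) \<le> 2 ^ d * N"
    by (simp add: b power_add)
  with a that show thesis by blast
qed

text \<open>The three constants are quantified before \<open>L\<close>, \<open>p\<close>,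
  \<open>f\<close> and \<open>N\<close> and thus depend on \<open>d\<close> only. The supremum is
  formed in the extended reals, where it needs no boundedness.\<close>

theorem corollary4p3:
  fixes d :: nat
  assumes "d > 0"
  shows "\<exists>Cdepth Cwidth Cparams :: real.
    \<forall>(L :: real) (p :: ereal) (f :: real vec \<Rightarrow> real).
      L > 0 \<longrightarrow> 1 \<le> p \<longrightarrow> lipschitz_pnorm p L (unit_cube d) f \<longrightarrow>
      (\<forall>N::nat. N \<ge> 2 \<longrightarrow>
        (\<exists>\<Phi>. is_mlp d 1 \<Phi> \<and>
             real (mlp_depth \<Phi>) \<le> Cdepth * ln (real N) \<and>
             real (mlp_width \<Phi>) \<le> Cwidth * real N \<and>
             real (mlp_nonzero_params \<Phi>) \<le> Cparams * real N \<and>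
             (SUP x\<in>unit_cube d. ereal \<bar>f x - mlp_fun \<Phi> x\<bar>)
               \<le> ereal (approx_const p d * L / real N powr (1 / real d)) \<and>
             lipschitz_pnorm p (L * real d powr min (inv_exponent p) (1 - inv_exponent p))
               (carrier_vec d) (mlp_fun \<Phi>)))"
proof -
  \<comment> \<open>These come from inserting \<open>2 ^ (a * d) \<le> 2 ^ d * N\<close> into the
    size bounds; additive terms are absorbed by \<open>N \<ge> 2\<close>, for the depth through
    \<open>ln 2 \<le> ln (real N)\<close>.\<close>
  define Cdepth where "Cdepth = (4 * real d + 4) / ln 2"
  define Cwidth where "Cwidth = d + 2 ^ d * 2 ^ d"
  define Cparams where "Cparams = 2 ^ d * 2 ^ d * (d + 13) + 2"
  have "\<exists>\<Phi>. is_mlp d 1 \<Phi> \<and>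
      real (mlp_depth \<Phi>) \<le> Cdepth * ln (real N) \<and>
      real (mlp_width \<Phi>) \<le> real Cwidth * real N \<and>
      real (mlp_nonzero_params \<Phi>) \<le> real Cparams * real N \<and>
      (SUP x\<in>unit_cube d. ereal \<bar>f x - mlp_fun \<Phi> x\<bar>)
        \<le> ereal (approx_const p d * L / real N powr (1 / real d)) \<and>
      lipschitz_pnorm p (L * real d powr min (inv_exponent p) (1 - inv_exponent p))
        (carrier_vec d) (mlp_fun \<Phi>)"
    if L: "L > 0" and p: "1 \<le> p" and f: "lipschitz_pnorm p L (unit_cube d) f" and N: "N \<ge> 2"
    for L :: real and p :: ereal and f :: "real vec \<Rightarrow> real" and N :: nat
  proof -
    obtain a where a: "N \<le> 2 ^ (a * d)" "2 ^ (a * d) \<le> 2 ^ d * N"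
      using ex_dyadic_scale[OF assms N] .
    obtain \<Phi> where \<Phi>: "is_mlp d 1 \<Phi>" "mlp_depth \<Phi> = 2 * d + 2 * (a * d) + 2"
        "mlp_width \<Phi> \<le> d + 2 ^ d * 2 ^ (a * d)"
        "mlp_nonzero_params \<Phi> \<le> 2 ^ d * 2 ^ (a * d) * (d + 13) + 2"
        "\<And>x. x \<in> unit_cube d \<Longrightarrow> \<bar>f x - mlp_fun \<Phi> x\<bar> \<le> approx_const p d * L / 2 ^ a"
        "lipschitz_pnorm p (L * real d powr min (inv_exponent p) (1 - inv_exponent p))
          (carrier_vec d) (mlp_fun \<Phi>)"
      using approximation_dyadic[OF assms p less_imp_le[OF L] f, of a] by blast
    have "real (mlp_depth \<Phi>) \<le> Cdepth * ln (real N)"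
    proof -
      have "real (2 ^ (a * d)) \<le> real (2 ^ d * N)"
        using a(2) by (rule of_nat_mono)
      then have "ln (2 ^ (a * d)) \<le> ln (2 ^ d * real N)"
        using N by (subst ln_le_cancel_iff) auto
      then have "real (a * d) * ln 2 \<le> real d * ln 2 + ln (real N)"
        using N by (simp add: ln_mult ln_realpow)
      moreover have "ln 2 \<le> ln (real N)" using N by simp
      moreover from this have "real d * ln 2 \<le> real d * ln (real N)"
        by (intro mult_left_mono) auto
      moreover have "ln (real N) \<le> 2 * ln (real N)" using N by simp
      ultimately have "(2 * real d + 2 * real (a * d) + 2) * ln 2 \<le> (4 * real d + 4) * ln (real N)"
        by (simp add: algebra_simps)
      then show ?thesis
        by (simp add: \<Phi>(2) Cdepth_def field_simps)
    qed
    moreover have "real (mlp_width \<Phi>) \<le> real Cwidth * real N"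
      unfolding of_nat_mult[symmetric] of_nat_le_iff
    proof -
      have "d + 2 ^ d * 2 ^ (a * d) \<le> d * N + 2 ^ d * (2 ^ d * N)"
        using a(2) N by (intro add_mono mult_left_mono) auto
      with \<Phi>(3) show "mlp_width \<Phi> \<le> Cwidth * N" by (simp add: Cwidth_def algebra_simps)
    qed
    moreover have "real (mlp_nonzero_params \<Phi>) \<le> real Cparams * real N"
      unfolding of_nat_mult[symmetric] of_nat_le_iff
    proof -
      have "2 ^ d * 2 ^ (a * d) * (d + 13) + 2 \<le> 2 ^ d * (2 ^ d * N) * (d + 13) + 2 * N"
        using a(2) N by (intro add_mono mult_mono) auto
      with \<Phi>(4) show "mlp_nonzero_params \<Phi> \<le> Cparams * N" by (simp add: Cparams_def algebra_simps)
    qed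
    moreover have "(SUP x\<in>unit_cube d. ereal \<bar>f x - mlp_fun \<Phi> x\<bar>)
        \<le> ereal (approx_const p d * L / real N powr (1 / real d))"
    proof (rule SUP_least)
      fix x assume x: "x \<in> unit_cube d"
      \<comment> \<open>Here the other inequality \<open>N \<le> 2 ^ (a * d)\<close> enters; its
        root of order \<open>d\<close> compares \<open>2 ^ a\<close> with the required rate.\<close>
      have "real N powr (1 / real d) \<le> (2 ^ (a * d)) powr (1 / real d)"
        using of_nat_mono[OF a(1), where 'a = real] by (intro powr_mono2) auto
      also have "\<dots> = 2 ^ a"
        using assms by (simp add: powr_powr flip: powr_realpow)
      finally have "approx_const p d * L / 2 ^ a \<le> approx_const p d * L / real N powr (1 / real d)"
        using L N by (intro divide_left_mono) (auto simp: approx_const_def)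
      with \<Phi>(5)[OF x] show "ereal \<bar>f x - mlp_fun \<Phi> x\<bar>
          \<le> ereal (approx_const p d * L / real N powr (1 / real d))"
        by simp
    qed
    ultimately show ?thesis
      using \<Phi>(1,6) by blast
  qed
  then show ?thesis by blast
qed

end
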